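(* Let $T_{m}$ be a complete caterpillar with $m$ stems, each of which has at least three pendant neighbors. Then \[\psi_{sq}(T_{m})=\beta_{2}(T_{m})=|L(T_{m})|,\] where $L(T_m)$ is the set of leaves of $T_m$.
   Context: All graphs are finite and simple (undirected, no loops, no multiple edges). For a graph $G=(V,E)$ and $v\in V$, $N_G[v]=\{v\}\cup\{u\in V: uv\in E\}$ is the closed neighborhood of $v$. A sub-quorum coloring of $G$ is an onto partial function $f:V\rightarrow\{1,2,\ldots,\ell\}$ such that for every vertex $v\in V$, if $f(v)$ is defined, then at least half of the vertices of $N_G[v]$ at which $f$ is defined have the same color (value of $f$) as $v$. The sub-quorum coloring number $\psi_{sq}(G)$ is the maximum value of $\ell$ over all sub-quorum colorings of $G$. A set $S\subseteq V$ is a $2$-independent set of $G$ if every vertex of $S$ has at most one neighbor in $S$; the $2$-independence number $\beta_2(G)$ is the maximum cardinality of a $2$-independent set of $G$. A leaf is a vertex of degree one. A caterpillar is a tree such that deleting all its leaves results in a path (with at least one vertex), called the spine of the caterpillar. A spine vertex is called a stem if it is adjacent to a leaf; a leaf adjacent to a stem $v$ is a pendant neighbor of $v$. A complete caterpillar is a caterpillar each of whose spine vertices is a stem. Thus a complete caterpillar with $m\ge 1$ stems has spine a path on $m$ vertices. *)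

theory Defs
  imports "Graph_Theory.Graph_Theory"
begin

text \<open>
  Finite simple undirected graphs are the instances of the locale \<^locale>\<open>graph\<close>: finite symmetric
  digraphs without loops and parallel arcs. An undirected edge is a pair of opposite arcs, so
  \<open>u \<rightarrow>\<^bsub>G\<^esub> v\<close> is the (symmetric) adjacency relation and \<^const>\<open>out_degree\<close> is the degree.
\<close>

definition closed_nbhd :: "('a, 'b) pre_digraph \<Rightarrow> 'a \<Rightarrow> 'a set" where
  "closed_nbhd G v = {v} \<union> {u \<in> verts G. u \<rightarrow>\<^bsub>G\<^esub> v}"


definition sub_quorum_coloring :: "('a, 'b) pre_digraph \<Rightarrow> nat \<Rightarrow> ('a \<rightharpoonup> nat) \<Rightarrow> bool" where
  "sub_quorum_coloring G l f \<longleftrightarrow>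
     dom f \<subseteq> verts G \<and> ran f = {1..l} \<and>
     (\<forall>v \<in> dom f. card (closed_nbhd G v \<inter> dom f) \<le> 2 * card {u \<in> closed_nbhd G v. f u = f v})"

definition sub_quorum_number :: "('a, 'b) pre_digraph \<Rightarrow> nat" where
  "sub_quorum_number G = Max {l. \<exists>f. sub_quorum_coloring G l f}"


definition two_independent :: "('a, 'b) pre_digraph \<Rightarrow> 'a set \<Rightarrow> bool" where
  "two_independent G S \<longleftrightarrow> S \<subseteq> verts G \<and> (\<forall>v \<in> S. card {u \<in> S. u \<rightarrow>\<^bsub>G\<^esub> v} \<le> 1)"

definition two_independence_number :: "('a, 'b) pre_digraph \<Rightarrow> nat" where
  "two_independence_number G = Max (card ` {S. two_independent G S})"


definition leaves :: "('a, 'b) pre_digraph \<Rightarrow> 'a set" where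
  "leaves G = {v \<in> verts G. out_degree G v = 1}"

text \<open>
  The library's \<^const>\<open>tree\<close> does not fit: it counts the two opposite arcs of an edge as a directed
  cycle of length 2. Cycles of undirected graphs are the directed cycles of length at least 3.
\<close>

definition undirected_tree :: "('a, 'b) pre_digraph \<Rightarrow> bool" where
  "undirected_tree G \<longleftrightarrow>
     graph G \<and> connected G \<and> \<not> (\<exists>p. pre_digraph.cycle G p \<and> 3 \<le> length p)"

definition path_graph :: "('a, 'b) pre_digraph \<Rightarrow> bool" where
  "path_graph G \<longleftrightarrow> graph G \<and>
     (\<exists>vs. vs \<noteq> [] \<and> distinct vs \<and> set vs = verts G \<and>
       (\<forall>i < length vs. \<forall>j < length vs. vs ! i \<rightarrow>\<^bsub>G\<^esub> vs ! j \<longleftrightarrow> i = Suc j \<or> j = Suc i))"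

definition spine :: "('a, 'b) pre_digraph \<Rightarrow> ('a, 'b) pre_digraph" where
  "spine G = G \<restriction> (verts G - leaves G)"

definition caterpillar :: "('a, 'b) pre_digraph \<Rightarrow> bool" where
  "caterpillar G \<longleftrightarrow> undirected_tree G \<and> path_graph (spine G)"

definition stems :: "('a, 'b) pre_digraph \<Rightarrow> 'a set" where
  "stems G = {v \<in> verts (spine G). \<exists>u \<in> leaves G. u \<rightarrow>\<^bsub>G\<^esub> v}"

definition pendant_neighbors :: "('a, 'b) pre_digraph \<Rightarrow> 'a \<Rightarrow> 'a set" where
  "pendant_neighbors G v = {u \<in> leaves G. u \<rightarrow>\<^bsub>G\<^esub> v}"

definition complete_caterpillar :: "('a, 'b) pre_digraph \<Rightarrow> bool" where
  "complete_caterpillar G \<longleftrightarrow> caterpillar G \<and> (\<forall>v \<in> verts (spine G). v \<in> stems G)"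


text \<open>Both maxima are taken over finite nonempty sets.\<close>

lemma sub_quorum_coloring_le:
  assumes "finite (verts G)" "sub_quorum_coloring G l f"
  shows "l \<le> card (verts G)"
proof -
  have dom: "dom f \<subseteq> verts G" and ran: "ran f = {1..l}"
    using assms(2) by (auto simp: sub_quorum_coloring_def)
  have fin: "finite (dom f)"
    using dom assms(1) by (rule finite_subset)
  have "ran f \<subseteq> (\<lambda>v. the (f v)) ` dom f"
  proof
    fix y assume "y \<in> ran f"
    then obtain v where "f v = Some y" by (auto simp: ran_def)
    then show "y \<in> (\<lambda>v. the (f v)) ` dom f" by (intro image_eqI[of _ _ v]) auto
  qed
  then have "card (ran f) \<le> card (dom f)"
    using fin by (rule surj_card_le[rotated])
  then have "l \<le> card (dom f)"
    by (simp add: ran)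
  also have "\<dots> \<le> card (verts G)"
    using dom assms(1) by (simp add: card_mono)
  finally show ?thesis .
qed

lemma sub_quorum_coloring_finite_nonempty:
  assumes "finite (verts G)"
  shows "finite {l. \<exists>f. sub_quorum_coloring G l f}" "{l. \<exists>f. sub_quorum_coloring G l f} \<noteq> {}"
proof -
  show "finite {l. \<exists>f. sub_quorum_coloring G l f}"
    by (rule finite_subset[where B = "{..card (verts G)}"])
      (auto intro: sub_quorum_coloring_le[OF assms])
  have "sub_quorum_coloring G 0 Map.empty"
    by (simp add: sub_quorum_coloring_def)
  then show "{l. \<exists>f. sub_quorum_coloring G l f} \<noteq> {}" by blast
qed

lemma two_independent_finite_nonempty:
  assumes "finite (verts G)"
  shows "finite {S. two_independent G S}" "{S. two_independent G S} \<noteq> {}"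
proof -
  show "finite {S. two_independent G S}"
    by (rule finite_subset[where B = "Pow (verts G)"]) (auto simp: two_independent_def assms)
  have "two_independent G {}"
    by (simp add: two_independent_def)
  then show "{S. two_independent G S} \<noteq> {}" by blast
qed

end

theory Submission
  imports Defs
begin

text \<open>
  Both invariants are at least the number of leaves: the leaves form an independent set, and
  giving them pairwise distinct colors, with nothing else colored, is a sub-quorum coloring.
  For the upper bounds, partition the vertices into the stars formed by a stem and its pendant
  neighbors. A 2-independent set containing a stem contains at most two vertices of its star.
  In a sub-quorum coloring, charge every color to the star of a leaf bearing it or, if there is
  none, to the first stem along the spine that bears it. A star is charged at most as many
  colors as it has leaves: this could only fail at a colored stem without like-colored leaves,
  but if such a stem is charged its own color, its only like-colored neighbor is its successor,
  and the quorum condition leaves it with at most two colored leaves.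
\<close>

lemma ran_restrict_eq: "ran (f |` A) = (the \<circ> f) ` (A \<inter> dom f)"
  by (force simp: ran_def restrict_map_def image_iff)

text \<open>What the counting uses of a complete caterpillar: \<open>vs\<close> lists the non-leaves
  in path order, so each stem has a predecessor and a successor by index. Adjacency on the spine is
  phrased in \<open>T\<close> itself, where neighborhoods are counted.\<close>

locale leafy_spine = graph T for T :: "('a, 'b) pre_digraph" +
  fixes vs :: "'a list"
  assumes distinct_vs: "distinct vs"
    and set_vs: "set vs = verts T - leaves T"
    and spine_adj: "\<lbrakk>i < length vs; j < length vs\<rbrakk> \<Longrightarrow> vs ! i \<rightarrow>\<^bsub>T\<^esub> vs ! j \<longleftrightarrow> i = Suc j \<or> j = Suc i"
    and leaves_not_adj: "\<lbrakk>u \<in> leaves T; v \<in> leaves T\<rbrakk> \<Longrightarrow> \<not> u \<rightarrow>\<^bsub>T\<^esub> v"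
    and three_pendants: "v \<in> set vs \<Longrightarrow> 3 \<le> card (pendant_neighbors T v)"

section \<open>Leaves and their unique neighbors\<close>

lemma (in wf_digraph) leaf_neighbor_exists:
  assumes "u \<in> leaves G"
  obtains v where "u \<rightarrow> v"
proof -
  have "card (out_arcs G u) = 1"
    using assms by (simp add: leaves_def out_degree_def)
  then obtain e where "out_arcs G u = {e}"
    by (auto simp: card_1_singleton_iff)
  then have "e \<in> arcs G" "tail G e = u"
    by (auto simp: out_arcs_def)
  then have "u \<rightarrow> head G e"
    by (auto intro!: dominatesI simp: arc_to_ends_def)
  then show thesis by (rule that)
qed

lemma (in wf_digraph) leaf_neighbor_unique:
  assumes "u \<in> leaves G" "u \<rightarrow> v" "u \<rightarrow> w"
  shows "v = w"
proof -
  have "card (out_arcs G u) = 1"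
    using assms by (simp add: leaves_def out_degree_def)
  then obtain e where e: "out_arcs G u = {e}"
    by (auto simp: card_1_singleton_iff)
  obtain a b where "a \<in> arcs G" "tail G a = u" "head G a = v"
    "b \<in> arcs G" "tail G b = u" "head G b = w"
    using assms(2,3) by (auto simp: arcs_ends_conv)
  moreover from this have "a \<in> out_arcs G u" "b \<in> out_arcs G u"
    by (auto simp: out_arcs_def)
  ultimately show ?thesis using e by auto
qed

text \<open>Each of the two leaves is the only neighbor of the other, so no walk from
  \<open>u\<close> leaves the pair, while connectedness makes every vertex reachable.\<close>

lemma (in sym_digraph) adjacent_leaves_exhaust:
  assumes conn: "connected G" and "u \<in> leaves G" "v \<in> leaves G" "u \<rightarrow> v"
  shows "verts G \<subseteq> {u, v}"
proof
  fix w assume w: "w \<in> verts G"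
  have "u \<in> verts G" using assms(2) by (simp add: leaves_def)
  then have "u \<rightarrow>\<^sup>* w"
    using symmetric_connected_imp_strongly_connected[OF sym_arcs conn] w
    by (auto simp: strongly_connected_def)
  moreover have "v \<rightarrow> u"
    using assms(4) sym_arcs by (rule arcs_ends_symmetric[rotated])
  ultimately show "w \<in> {u, v}"
    using assms(2-4) by (induction rule: reachable_induct) (auto dest: leaf_neighbor_unique)
qed

section \<open>Partition of the leaves among the stems\<close>

context leafy_spine
begin

abbreviation pendants :: "'a \<Rightarrow> 'a set" where
  "pendants \<equiv> pendant_neighbors T"

lemma adj_sym: "u \<rightarrow>\<^bsub>T\<^esub> v \<Longrightarrow> v \<rightarrow>\<^bsub>T\<^esub> u"
  using sym_arcs by (rule arcs_ends_symmetric)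

lemma finite_leaves: "finite (leaves T)"
  by (simp add: leaves_def)

lemma finite_pendants: "finite (pendants v)"
  using finite_leaves by (simp add: pendant_neighbors_def)

lemma leaves_eq_pendants: "leaves T = (\<Union>v\<in>set vs. pendants v)"
proof
  show "leaves T \<subseteq> (\<Union>v\<in>set vs. pendants v)"
  proof
    fix u assume u: "u \<in> leaves T"
    then obtain v where v: "u \<rightarrow>\<^bsub>T\<^esub> v" by (rule leaf_neighbor_exists)
    then have "v \<in> set vs"
      using u leaves_not_adj set_vs by auto
    with u v show "u \<in> (\<Union>v\<in>set vs. pendants v)"
      by (auto simp: pendant_neighbors_def)
  qed
qed (auto simp: pendant_neighbors_def)

text \<open>A leaf has only one neighbor, so distinct stems share no pendants. Through this identity
  the bounds for single stars add up to the number of leaves.\<close>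

lemma card_leaves: "card (leaves T) = (\<Sum>v\<in>set vs. card (pendants v))"
  unfolding leaves_eq_pendants
proof (rule card_UN_disjoint)
  show "\<forall>v\<in>set vs. \<forall>w\<in>set vs. v \<noteq> w \<longrightarrow> pendants v \<inter> pendants w = {}"
    by (auto simp: pendant_neighbors_def dest: leaf_neighbor_unique)
qed (auto simp: finite_pendants)

lemma verts_cases:
  assumes "u \<in> verts T"
  obtains "u \<in> leaves T" | i where "i < length vs" "u = vs ! i"
  using assms set_vs by (metis DiffI in_set_conv_nth)

section \<open>2-independent sets\<close>

lemma two_independent_leaves: "two_independent T (leaves T)"
proof -
  have "card {u \<in> leaves T. u \<rightarrow>\<^bsub>T\<^esub> v} = 0" if "v \<in> leaves T" for v
    using leaves_not_adj that by (metis (no_types, lifting) Collect_empty_eq card.empty)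
  moreover have "leaves T \<subseteq> verts T" by (auto simp: leaves_def)
  ultimately show ?thesis by (simp add: two_independent_def)
qed

text \<open>A stem in \<open>S\<close> admits at most one of its pendants into \<open>S\<close>,
  which makes two vertices against at least three pendants. If the stem is outside \<open>S\<close>,
  only pendants remain.\<close>

lemma two_independent_card_star_le:
  assumes "two_independent T S" "v \<in> set vs"
  shows "card (S \<inter> insert v (pendants v)) \<le> card (pendants v)"
proof (cases "v \<in> S")
  case True
  have "finite S"
    using assms(1) by (auto simp: two_independent_def intro: finite_subset)
  then have "card (S \<inter> pendants v) \<le> card {u \<in> S. u \<rightarrow>\<^bsub>T\<^esub> v}"
    by (intro card_mono) (auto simp: pendant_neighbors_def)
  also have "\<dots> \<le> 1"
    using assms(1) True by (simp add: two_independent_def)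
  finally have "card (insert v (S \<inter> pendants v)) \<le> 2"
    using \<open>finite S\<close> by (simp add: card_insert_if)
  moreover have "S \<inter> insert v (pendants v) = insert v (S \<inter> pendants v)"
    using True by auto
  ultimately show ?thesis
    using three_pendants[OF assms(2)] by simp
next
  case False
  then have "S \<inter> insert v (pendants v) \<subseteq> pendants v" by auto
  then show ?thesis using finite_pendants by (rule card_mono[rotated])
qed

lemma two_independent_card_le:
  assumes "two_independent T S"
  shows "card S \<le> card (leaves T)"
proof -
  have "S \<subseteq> verts T" using assms by (simp add: two_independent_def)
  then have "S \<subseteq> set vs \<union> leaves T" using set_vs by blast
  then have "S = (\<Union>v\<in>set vs. S \<inter> insert v (pendants v))"
    unfolding leaves_eq_pendants by blast
  then have "card S \<le> (\<Sum>v\<in>set vs. card (S \<inter> insert v (pendants v)))"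
    by (metis card_UN_le finite_set)
  also have "\<dots> \<le> (\<Sum>v\<in>set vs. card (pendants v))"
    using assms by (intro sum_mono two_independent_card_star_le)
  finally show ?thesis by (simp add: card_leaves)
qed

section \<open>Sub-quorum colorings\<close>

lemma sub_quorum_coloring_leaves: "\<exists>f. sub_quorum_coloring T (card (leaves T)) f"
proof -
  obtain c where c: "bij_betw c (leaves T) {1..card (leaves T)}"
    using finite_same_card_bij[of "leaves T" "{1..card (leaves T)}"] finite_leaves by auto
  define f where "f = (\<lambda>v. if v \<in> leaves T then Some (c v) else None)"
  have dom: "dom f = leaves T" by (auto simp: f_def dom_def)
  have "ran f = c ` leaves T" by (auto simp: f_def ran_def)
  then have "ran f = {1..card (leaves T)}"
    using c by (simp add: bij_betw_def)
  moreover have "card (closed_nbhd T v \<inter> leaves T) \<le> 2 * card {u \<in> closed_nbhd T v. f u = f v}"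
    if "v \<in> leaves T" for v
  proof -
    \<comment> \<open>The neighbor of a leaf is an uncolored stem, so the quorum condition reduces
      to 1 \<le> 2.\<close>
    have "closed_nbhd T v \<inter> leaves T = {v}"
      using that leaves_not_adj by (auto simp: closed_nbhd_def)
    moreover have "card {v} \<le> card {u \<in> closed_nbhd T v. f u = f v}"
      by (rule card_mono) (auto simp: closed_nbhd_def)
    ultimately show ?thesis by simp
  qed
  ultimately have "sub_quorum_coloring T (card (leaves T)) f"
    by (simp add: sub_quorum_coloring_def dom) (simp add: leaves_def)
  then show ?thesis by blast
qed

text \<open>Has at most one element. Comparing only with the predecessor detects the start of every
  run of a color along the spine, not just its first occurrence. Charging a color several times is
  harmless for an upper bound, and this local condition is what the quorum argument uses.\<close>

definition first_color :: "('a \<rightharpoonup> nat) \<Rightarrow> nat \<Rightarrow> nat set" where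
  "first_color f i = {c. f (vs ! i) = Some c \<and> (\<forall>j. i = Suc j \<longrightarrow> f (vs ! j) \<noteq> Some c)}"

definition charged :: "('a \<rightharpoonup> nat) \<Rightarrow> nat \<Rightarrow> nat set" where
  "charged f i = ran (f |` pendants (vs ! i)) \<union> first_color f i"

lemma ran_subset_charged:
  assumes "dom f \<subseteq> verts T"
  shows "ran f \<subseteq> (\<Union>i<length vs. charged f i)"
proof
  fix c assume "c \<in> ran f"
  then obtain u where u: "f u = Some c" by (auto simp: ran_def)
  with assms have "u \<in> verts T" by auto
  then show "c \<in> (\<Union>i<length vs. charged f i)"
  proof (cases rule: verts_cases)
    case 1
    then obtain v where "v \<in> set vs" "u \<in> pendants v"
      using leaves_eq_pendants by auto
    then obtain i where i: "i < length vs" "u \<in> pendants (vs ! i)"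
      by (metis in_set_conv_nth)
    then have "c \<in> ran (f |` pendants (vs ! i))"
      using u by (auto simp: ran_def restrict_map_def)
    with i show ?thesis by (auto simp: charged_def)
  next
    case (2 k)
    \<comment> \<open>The least index bearing \<open>c\<close> starts a run of \<open>c\<close>. The
      minimum ranges over all naturals, but \<open>i \<le> k\<close> keeps it inside the
      list.\<close>
    define i where "i = (LEAST i. f (vs ! i) = Some c)"
    have "f (vs ! i) = Some c"
      unfolding i_def by (rule LeastI[of _ k]) (use 2 u in simp)
    moreover have "f (vs ! j) \<noteq> Some c" if "i = Suc j" for j
      using not_less_Least[of j "\<lambda>i. f (vs ! i) = Some c"] that unfolding i_def by simp
    ultimately have "c \<in> first_color f i" by (auto simp: first_color_def)
    moreover have "i \<le> k"
      unfolding i_def by (rule Least_le) (use 2 u in simp)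
    ultimately show ?thesis using 2 by (auto simp: charged_def)
  qed
qed

text \<open>The predecessor lacks color \<open>c\<close> by \<open>first_color\<close> and the
  pendants lack it by \<open>no\<close>, so only the stem and possibly its successor bear it. The
  quorum condition then bounds all colored vertices of the closed neighborhood, pendants
  included.\<close>

lemma colored_pendants_le_2:
  assumes f: "sub_quorum_coloring T l f" and i: "i < length vs"
    and c: "c \<in> first_color f i"
    and no: "\<And>u. u \<in> pendants (vs ! i) \<Longrightarrow> f u \<noteq> Some c"
  shows "card (pendants (vs ! i) \<inter> dom f) \<le> 2"
proof -
  \<comment> \<open>\<open>?w\<close> is a vertex of the spine only if
    \<open>Suc i < length vs\<close>; the facts about it below carry this bound.\<close>
  let ?v = "vs ! i" and ?w = "vs ! Suc i"
  let ?N = "closed_nbhd T ?v" and ?K = "pendants ?v \<inter> dom f"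
  let ?same = "{u \<in> ?N. f u = f ?v}"
  have fv: "f ?v = Some c" using c by (simp add: first_color_def)
  have quorum: "card (?N \<inter> dom f) \<le> 2 * card ?same"
    using f fv unfolding sub_quorum_coloring_def by blast
  have fin: "finite (?N \<inter> dom f)" by (simp add: closed_nbhd_def)
  have finK: "finite ?K" using finite_pendants by simp
  have v_leaf: "?v \<notin> leaves T" using i set_vs nth_mem by blast
  have K_sub: "?K \<subseteq> ?N"
    by (auto simp: closed_nbhd_def pendant_neighbors_def leaves_def)
  have v_K: "?v \<notin> ?K" using v_leaf by (simp add: pendant_neighbors_def)
  have same: "u = ?v \<or> Suc i < length vs \<and> u = ?w" if u: "u \<in> ?same" for u
  proof (cases "u = ?v")
    case False
    then have "u \<in> verts T" and adj: "u \<rightarrow>\<^bsub>T\<^esub> ?v" and fu: "f u = Some c"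
      using u fv by (auto simp: closed_nbhd_def)
    from this(1) show ?thesis
    proof (cases rule: verts_cases)
      case 1
      then show ?thesis using adj fu no by (simp add: pendant_neighbors_def)
    next
      case (2 j)
      then have "i = Suc j \<or> j = Suc i" using spine_adj i adj by blast
      then show ?thesis using 2 c fu by (auto simp: first_color_def)
    qed
  qed simp
  show ?thesis
  proof (cases "Suc i < length vs \<and> f ?w = Some c")
    case True
    then have w: "?w \<in> set vs" and "?w \<rightarrow>\<^bsub>T\<^esub> ?v" using spine_adj i by auto
    then have "?w \<in> ?N" using set_vs by (simp add: closed_nbhd_def)
    then have "insert ?v (insert ?w ?K) \<subseteq> ?N \<inter> dom f"
      using K_sub fv True by (auto simp: closed_nbhd_def)
    \<comment> \<open>Two like-colored vertices allow at most four colored ones; \<open>?v\<close>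
      and \<open>?w\<close> are two of these, which leaves two for the pendants.\<close>
    then have "card (insert ?v (insert ?w ?K)) \<le> card (?N \<inter> dom f)"
      using fin by (intro card_mono)
    moreover have "card (insert ?v (insert ?w ?K)) = Suc (Suc (card ?K))"
    proof -
      have "?w \<notin> ?K" using w set_vs by (auto simp: pendant_neighbors_def)
      moreover have "?v \<noteq> ?w" using distinct_vs True i by (simp add: nth_eq_iff_index_eq)
      ultimately show ?thesis using v_K finK by simp
    qed
    moreover have "card ?same \<le> card {?v, ?w}"
      by (rule card_mono) (use same in auto)
    moreover have "card {?v, ?w} \<le> 2" by (simp add: card_insert_if)
    ultimately show ?thesis using quorum by linarith
  next
    case False
    \<comment> \<open>The stem stands alone with its color, so at most two vertices are colored, and
      even one pendant at most.\<close>
    then have "?same \<subseteq> {?v}" using same fv by auto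
    then have "card ?same \<le> card {?v}" by (intro card_mono) auto
    moreover have "card (insert ?v ?K) \<le> card (?N \<inter> dom f)"
      using fin K_sub fv by (intro card_mono) (auto simp: closed_nbhd_def)
    ultimately show ?thesis using quorum v_K finK by simp
  qed
qed

text \<open>The pendants supply at most one color per colored pendant, so only a stem color absent
  from them could exceed the bound. In that case at most two pendants are colored, and 2 + 1 colors
  do not exceed the three or more pendants.\<close>

lemma card_charged_le:
  assumes f: "sub_quorum_coloring T l f" and i: "i < length vs"
  shows "card (charged f i) \<le> card (pendants (vs ! i))"
proof -
  let ?P = "pendants (vs ! i)"
  have ran_K: "card (ran (f |` ?P)) \<le> card (?P \<inter> dom f)"
    unfolding ran_restrict_eq using finite_pendants by (intro card_image_le) simp
  have K_P: "card (?P \<inter> dom f) \<le> card ?P"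
    using finite_pendants by (intro card_mono) auto
  show ?thesis
  proof (cases "first_color f i \<subseteq> ran (f |` ?P)")
    case True
    then have "charged f i = ran (f |` ?P)" by (auto simp: charged_def)
    then show ?thesis using ran_K K_P by simp
  next
    case False
    then obtain c where c: "c \<in> first_color f i" and no: "c \<notin> ran (f |` ?P)" by auto
    have "f u \<noteq> Some c" if "u \<in> ?P" for u
      using no that by (metis ranI restrict_in)
    then have "card (?P \<inter> dom f) \<le> 2"
      using colored_pendants_le_2[OF f i c] by blast
    moreover have "first_color f i = {c}" using c by (auto simp: first_color_def)
    then have "card (charged f i) \<le> card (ran (f |` ?P)) + 1"
      by (metis card_Un_le charged_def is_singletonI is_singleton_altdef)
    ultimately show ?thesis
      using ran_K three_pendants[of "vs ! i"] i by simp
  qed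
qed

lemma sub_quorum_coloring_le_leaves:
  assumes f: "sub_quorum_coloring T l f"
  shows "l \<le> card (leaves T)"
proof -
  have dom: "dom f \<subseteq> verts T" and ran: "ran f = {1..l}"
    using f by (auto simp: sub_quorum_coloring_def)
  have "finite (charged f i)" for i
    by (auto simp: charged_def ran_restrict_eq first_color_def finite_pendants
        intro: finite_subset[of _ "{the (f (vs ! i))}"])
  then have "card (ran f) \<le> card (\<Union>i<length vs. charged f i)"
    using ran_subset_charged[OF dom] by (intro card_mono) auto
  also have "\<dots> \<le> (\<Sum>i<length vs. card (charged f i))"
    by (intro card_UN_le) simp
  also have "\<dots> \<le> (\<Sum>i<length vs. card (pendants (vs ! i)))"
    by (intro sum_mono card_charged_le[OF f]) simp
  also have "\<dots> = (\<Sum>v\<in>set vs. card (pendants v))"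
    \<comment> \<open>As \<open>vs\<close> is distinct, indices correspond one to one to
      stems.\<close>
    by (intro sum.reindex_bij_betw bij_betw_nth) (use distinct_vs in auto)
  finally show ?thesis by (simp add: ran card_leaves)
qed

section \<open>Values of the two invariants\<close>

lemma two_independence_number_eq: "two_independence_number T = card (leaves T)"
  unfolding two_independence_number_def
proof (rule Max_eqI)
  show "finite (card ` {S. two_independent T S})"
    by (intro finite_imageI two_independent_finite_nonempty) simp
qed (use two_independent_card_le two_independent_leaves in auto)

lemma sub_quorum_number_eq: "sub_quorum_number T = card (leaves T)"
  unfolding sub_quorum_number_def
proof (rule Max_eqI)
  show "finite {l. \<exists>f. sub_quorum_coloring T l f}"
    by (rule sub_quorum_coloring_finite_nonempty) simp
qed (use sub_quorum_coloring_le_leaves sub_quorum_coloring_leaves in auto)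

end

section \<open>From complete caterpillars to the locale\<close>

lemma complete_caterpillar_leafy_spine:
  assumes "graph T" "complete_caterpillar T"
    and "\<forall>v \<in> stems T. card (pendant_neighbors T v) \<ge> 3"
  obtains vs where "leafy_spine T vs"
proof -
  interpret graph T by fact
  have conn: "connected T" and path: "path_graph (spine T)"
    and stems: "\<forall>v \<in> verts (spine T). v \<in> stems T"
    using assms(2)
    by (auto simp: complete_caterpillar_def caterpillar_def undirected_tree_def)
  from path obtain vs where vs: "vs \<noteq> []" "distinct vs" "set vs = verts (spine T)"
    and adj: "\<And>i j. \<lbrakk>i < length vs; j < length vs\<rbrakk> \<Longrightarrow>
      vs ! i \<rightarrow>\<^bsub>spine T\<^esub> vs ! j \<longleftrightarrow> i = Suc j \<or> j = Suc i"
    by (auto simp: path_graph_def)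
  have set_vs: "set vs = verts T - leaves T" using vs(3) by (simp add: spine_def)
  \<comment> \<open>The spine is an induced subgraph, so it keeps every arc between its
    vertices.\<close>
  have spine_iff: "u \<rightarrow>\<^bsub>spine T\<^esub> v \<longleftrightarrow> u \<rightarrow>\<^bsub>T\<^esub> v" if "u \<in> set vs" "v \<in> set vs" for u v
    using that unfolding set_vs spine_def arcs_ends_conv by force
  have "leafy_spine T vs"
  proof unfold_locales
    fix i j assume "i < length vs" "j < length vs"
    then show "vs ! i \<rightarrow>\<^bsub>T\<^esub> vs ! j \<longleftrightarrow> i = Suc j \<or> j = Suc i"
      using adj spine_iff nth_mem by metis
  next
    fix u v assume "u \<in> leaves T" "v \<in> leaves T"
    then show "\<not> u \<rightarrow>\<^bsub>T\<^esub> v"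
      \<comment> \<open>Two adjacent leaves would be all the vertices, but the head of the nonempty
        \<open>vs\<close> is a vertex that is not a leaf.\<close>
      using adjacent_leaves_exhaust[OF conn, of u v] vs(1) set_vs
      by (metis Diff_iff insert_iff empty_iff list.set_sel(1) subsetD)
  qed (use vs set_vs stems assms(3) in auto)
  then show thesis by (rule that)
qed

theorem theorem18:
  fixes T :: "('a, 'b) pre_digraph" and m :: nat
  assumes "graph T"
    and "complete_caterpillar T"
    and "card (stems T) = m"
    and "m \<ge> 1"
    and "\<forall>v \<in> stems T. card (pendant_neighbors T v) \<ge> 3"
  shows "sub_quorum_number T = two_independence_number T \<and>
         two_independence_number T = card (leaves T)"
proof -
  obtain vs where "leafy_spine T vs"
    using complete_caterpillar_leafy_spine[OF assms(1,2,5)] .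
  then interpret leafy_spine T vs .
  show ?thesis
    by (simp add: two_independence_number_eq sub_quorum_number_eq)
qed

end
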